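(* Let $a$ be an integer, $n$ an even nonnegative integer, and $q$ an odd prime power such that $a\neq 0$ in $\mathbb{F}_q$. Let $d=\gcd(n,q-1)$ and $\delta=\gcd(n,q+1)$, and let $2^r$ be the highest power of $2$ dividing $q^2-1$. Then the sum $S_q(D_n(x,a))\in\mathbb{F}_q$ of the distinct elements in the image of the Dickson polynomial $D_n(x,a)$ on $\mathbb{F}_q$ equals $T_1+T_2+T_3$, where $$T_1=\begin{cases}0 & \text{if } 2^{r-1}\mid n,\\ -\chi_q(a)^{\frac nd+\frac n\delta}\,a^{n/2} & \text{otherwise,}\end{cases}\qquad T_2=\begin{cases}\chi_q(a)^{\frac nd}\,a^{n/2} & \text{if }(q-1)\mid n,\\ 0&\text{otherwise,}\end{cases}\qquad T_3=\begin{cases}\chi_q(a)^{\frac n\delta}\,a^{n/2} & \text{if }(q+1)\mid n,\\ 0&\text{otherwise.}\end{cases}$$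
   Context: The Dickson polynomials are defined by $D_0(x,a)=2$, $D_1(x,a)=x$, and $D_n(x,a)=xD_{n-1}(x,a)-aD_{n-2}(x,a)$ for $n\ge 2$. For an integral polynomial $f$, $\mathfrak{R}_q(f)\subseteq\mathbb{F}_q$ is the set of values taken by $f$ on $\mathbb{F}_q$, and $S_q(f)=\sum_{y\in\mathfrak{R}_q(f)}y\in\mathbb{F}_q$ is the sum of the distinct values. The integer $a$ is also viewed as an element of $\mathbb{F}_q$ via its image. $\chi_q$ is the quadratic character on $\mathbb{F}_q$: $\chi_q(a)=a^{(q-1)/2}$, equal to $0$ if $a=0$, $1$ if $a$ is a nonzero square in $\mathbb{F}_q$, and $-1$ if $a$ is a non-square. *)

theory Defs
  imports
    "HOL-Library.Cardinality"
    "HOL-Computational_Algebra.Computational_Algebra"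
    "HOL-Number_Theory.Prime_Powers"
begin

fun dickson_poly :: "nat \<Rightarrow> 'a::comm_ring_1 \<Rightarrow> 'a poly" where
  "dickson_poly 0 a = [:2:]"
| "dickson_poly (Suc 0) a = [:0, 1:]"
| "dickson_poly (Suc (Suc n)) a = [:0, 1:] * dickson_poly (Suc n) a - [:a:] * dickson_poly n a"

definition value_set :: "int poly \<Rightarrow> 'k::finite_field set" where
  "value_set f = range (poly (map_poly of_int f))"

definition value_sum :: "int poly \<Rightarrow> 'k::finite_field" where
  "value_sum f = (\<Sum>y\<in>value_set f. y)"

text \<open>
  The quadratic character takes its values \<open>0, 1, -1\<close> in the field itself; for odd order, the
  lemma \<open>quadratic_char_eq\<close> identifies the power with the usual case distinction.
\<close>

definition quadratic_char :: "'k::finite_field \<Rightarrow> 'k" where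
  "quadratic_char x = x ^ ((CARD('k) - 1) div 2)"

lemma quadratic_char_eq:
  fixes x :: "'k::finite_field"
  assumes "odd CARD('k)"
  shows "quadratic_char x = (if x = 0 then 0 else if \<exists>y. x = y ^ 2 then 1 else -1)"
proof -
  obtain m where q: "CARD('k) = 2 * m + 1"
    using assms by (rule oddE)
  have "card {0, 1 :: 'k} \<le> CARD('k)"
    by (intro card_mono) auto
  hence m: "m > 0" using q by simp
  have chi: "quadratic_char z = z ^ m" for z :: 'k
    by (simp add: quadratic_char_def q)
  have fermat: "z ^ (2 * m) = 1" if "z \<noteq> 0" for z :: 'k
    using finite_field_power_card_eq_same[of z] that by (simp add: q)
  define S where "S = (\<lambda>y::'k. y ^ 2) ` (- {0})"
  define R where "R = {z::'k. z ^ m = 1}"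
  have SR: "S \<subseteq> R"
    using fermat by (auto simp: S_def R_def simp flip: power_mult)
  have "R = {z. poly (monom 1 m + [:-1:]) z = 0}"
    by (auto simp: R_def poly_monom)
  moreover have deg: "degree (monom 1 m + [:-1:] :: 'k poly) = m"
    using m by (subst degree_add_eq_left) (auto simp: degree_monom_eq)
  ultimately have "card R \<le> m"
    using card_poly_roots_bound[of "monom 1 m + [:-1:] :: 'k poly"] m by force
  moreover have "card (- {0 :: 'k}) \<le> card S * 2"
  proof -
    have "- {0} = (\<Union>s\<in>S. {y::'k. y \<noteq> 0 \<and> y ^ 2 = s})"
      by (auto simp: S_def)
    also have "card \<dots> \<le> (\<Sum>s\<in>S. card {y::'k. y \<noteq> 0 \<and> y ^ 2 = s})"
      by (rule card_UN_le) simp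
    also have "\<dots> \<le> (\<Sum>s\<in>S. 2)"
    proof (rule sum_mono)
      fix s assume "s \<in> S"
      then obtain w where w: "s = w ^ 2" by (auto simp: S_def)
      have "card {y::'k. y \<noteq> 0 \<and> y ^ 2 = s} \<le> card {w, - w}"
        by (rule card_mono) (auto simp: w power2_eq_iff)
      also have "\<dots> \<le> 2" by (simp add: card_insert_if)
      finally show "card {y::'k. y \<noteq> 0 \<and> y ^ 2 = s} \<le> 2" .
    qed
    finally show ?thesis by simp
  qed
  moreover have "card (- {0 :: 'k}) = 2 * m"
    using q by (simp add: Compl_eq_Diff_UNIV card_Diff_singleton)
  ultimately have "S = R"
    by (intro card_subset_eq SR) (use card_mono[OF _ SR] in auto)
  hence sq: "(\<exists>y. x = y ^ 2) \<longleftrightarrow> x ^ m = 1" if "x \<noteq> 0"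
  proof -
    have "(\<exists>y. x = y ^ 2) \<longleftrightarrow> x \<in> S"
      using that by (auto simp: S_def)
    thus ?thesis using \<open>S = R\<close> by (simp add: R_def)
  qed
  have "(x ^ m) ^ 2 = 1" if "x \<noteq> 0"
    using fermat[OF that] by (simp add: mult.commute flip: power_mult)
  thus ?thesis
    using sq m by (auto simp: chi power2_eq_1_iff)
qed

end

theory Submission
  imports Defs "HOL-Number_Theory.Residues" "HOL-Algebra.Algebraic_Closure_Type"
begin

text \<open>
  Over the algebraic closure of \<open>F\<^sub>q\<close> every \<open>x \<in> F\<^sub>q\<close> has the form \<open>y + a / y\<close> with
  \<open>y\<^bsup>q-1\<^esup> = 1\<close> or \<open>y\<^bsup>q+1\<^esup> = a\<close>, and then \<open>D\<^sub>n(x, a) = u + a\<^sup>n / u\<close> for \<open>u = y\<^sup>n\<close>. The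
  \<open>n\<close>-th powers of the two kinds of \<open>y\<close> form two cosets \<open>H\<^sub>1\<close>, \<open>H\<^sub>2\<close> of groups of roots of
  unity, each invariant under the involution \<open>u \<mapsto> a\<^sup>n / u\<close>, whose orbits correspond to
  the values. Hence the sum of the values is the sum of \<open>H\<^sub>1\<close> (giving \<open>T2\<close>) plus the sum of
  \<open>H\<^sub>2\<close> (giving \<open>T3\<close>) plus a correction from the fixed points \<open>\<plusminus>a\<^bsup>n/2\<^esup>\<close> that lie
  in exactly one of the two cosets (giving \<open>T1\<close>).
\<close>

section \<open>Dickson polynomials under the substitution \<open>x = y + a / y\<close>\<close>

lemma map_poly_of_int_dickson_poly:
  "map_poly of_int (dickson_poly n a) = dickson_poly n (of_int a :: 'a::comm_ring_1)"
proof (induction n a rule: dickson_poly.induct)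
  case (3 n a)
  have "map_poly of_int ([:0, 1:] * p - [:a:] * r) =
      [:0, 1:] * map_poly of_int p - [:of_int a :: 'a:] * map_poly of_int r" for p r
    by (rule poly_eqI) (simp add: coeff_map_poly coeff_pCons split: nat.split)
  with 3 show ?case by simp
qed (simp_all add: map_poly_pCons)

text \<open>\<open>y\<close> and \<open>a / y\<close> have product \<open>a\<close>, so the sums of
  their n-th powers satisfy the Dickson recurrence.\<close>

lemma poly_dickson_poly_plus_div:
  fixes y :: "'a::field"
  assumes "y \<noteq> 0"
  shows "poly (dickson_poly n a) (y + a / y) = y ^ n + a ^ n / y ^ n"
  using assms by (induction n a rule: dickson_poly.induct) (simp_all add: field_simps)

lemma to_ac_poly_dickson_poly:
  "to_ac (poly (dickson_poly n a) x) = poly (dickson_poly n (to_ac a)) (to_ac x)"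
  by (induction n a rule: dickson_poly.induct) simp_all

section \<open>Solutions of \<open>u ^ m = c\<close> in an algebraically closed field\<close>

lemma finite_nth_roots_field:
  fixes c :: "'a::field"
  assumes "m > 0"
  shows "finite {u. u ^ m = c}"
proof -
  have "Polynomial.coeff (Polynomial.monom 1 m - [:c:]) m = 1"
    using assms by (simp add: coeff_pCons split: nat.split)
  hence "Polynomial.monom 1 m - [:c:] \<noteq> 0"
    by (metis Polynomial.coeff_0 zero_neq_one)
  from poly_roots_finite[OF this] show ?thesis
    by (simp add: Polynomial.poly_monom)
qed

text \<open>Multiplication by a nontrivial m-th root of unity permutes the solutions, so their sum
  is unchanged by a factor other than 1 and vanishes.\<close>

lemma sum_nth_roots_alg_closed:
  fixes c :: "'a::alg_closed_field"
  assumes "of_nat m \<noteq> (0::'a)"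
  shows "(\<Sum>u | u ^ m = c. u) = (if m = 1 then c else 0)"
proof (cases "m = 1")
  case False
  with assms have m: "m > 1" by (cases m) auto
  \<comment> \<open>A root \<open>z\<close> of 1 + X + ... + X^(m-1) has \<open>z ^ m = 1\<close>,
    and it differs from 1 because the value at 1 is \<open>of_nat m\<close>, which is
    nonzero.\<close>
  define p :: "'a poly" where "p = (\<Sum>i<m. Polynomial.monom 1 i)"
  have "Polynomial.coeff p (m - 1) = 1"
    using m by (simp add: p_def coeff_sum if_distrib cong: if_cong)
  hence "Polynomial.degree p > 0"
    using m Polynomial.le_degree[of p "m - 1"] by simp
  then obtain z where "poly p z = 0"
    using alg_closed_imp_poly_has_root by blast
  hence z: "(\<Sum>i<m. z ^ i) = 0"
    by (simp add: p_def poly_sum Polynomial.poly_monom)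
  have "z \<noteq> 1" using z assms by auto
  have "z ^ m = 1"
    using z power_diff_1_eq[of z m] by simp
  hence "z \<noteq> 0" using m by (auto simp: power_0_left)
  have "(\<Sum>u | u ^ m = c. u) = (\<Sum>u | u ^ m = c. z * u)"
    by (rule sum.reindex_bij_witness[of _ "\<lambda>u. z * u" "\<lambda>u. u / z"])
      (use \<open>z ^ m = 1\<close> \<open>z \<noteq> 0\<close> in \<open>auto simp: power_mult_distrib power_divide\<close>)
  also have "\<dots> = z * (\<Sum>u | u ^ m = c. u)"
    by (simp add: sum_distrib_left)
  finally show ?thesis using \<open>z \<noteq> 1\<close> False by simp
qed simp

text \<open>For the harder inclusion, dividing by the n-th power of one fixed root \<open>z\<close>
  of \<open>z ^ N = c\<close> reduces the claim to roots of unity, where Bezout applies.\<close>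

lemma power_image_nth_roots:
  fixes c :: "'a::alg_closed_field"
  assumes "N > 0" "c \<noteq> 0"
  shows "(\<lambda>y. y ^ n) ` {y. y ^ N = c} = {u. u ^ (N div gcd n N) = c ^ (n div gcd n N)}"
proof (intro equalityI subsetI)
  fix u assume "u \<in> (\<lambda>y. y ^ n) ` {y. y ^ N = c}"
  then obtain y where y: "y ^ N = c" "u = y ^ n" by auto
  have "n * (N div gcd n N) = N * (n div gcd n N)"
    by (metis div_mult_swap gcd_dvd1 gcd_dvd2 mult.commute)
  with y show "u \<in> {u. u ^ (N div gcd n N) = c ^ (n div gcd n N)}"
    by (metis (mono_tags) mem_Collect_eq power_mult)
next
  define g where "g = gcd n N"
  have g: "g > 0" "g * (N div g) = N" "g * (n div g) = n"
    using assms by (auto simp: g_def)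
  fix u assume "u \<in> {u. u ^ (N div gcd n N) = c ^ (n div gcd n N)}"
  hence u: "u ^ (N div g) = c ^ (n div g)" by (simp add: g_def)
  obtain z where z: "z ^ N = c" using nth_root_exists[OF assms(1)] by blast
  have "z \<noteq> 0" using z assms by auto
  have "(z ^ n) ^ (N div g) = z ^ (N * (n div g))"
    by (subst power_mult[symmetric]) (metis g(2,3) mult.assoc mult.commute)
  also have "\<dots> = c ^ (n div g)" by (simp add: power_mult z)
  finally have v: "(u / z ^ n) ^ (N div g) = 1"
    using u assms by (simp add: power_divide)
  obtain w where w: "w ^ g = u / z ^ n" using nth_root_exists[OF g(1)] by blast
  have wN: "w ^ N = 1" using v by (metis g(2) power_mult w)
  obtain y where y: "y ^ N = 1" "y ^ n = u / z ^ n"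
  proof (cases "n = 0")
    case True
    hence "u / z ^ n = 1" using w wN by (simp add: g_def)
    thus ?thesis using that[of 1] by (simp add: True)
  next
    case False
    \<comment> \<open>Since \<open>w ^ N = 1\<close>, this exponent identity turns the g-th power of
      \<open>w\<close> into the n-th power of \<open>w ^ s\<close>.\<close>
    then obtain s t where st: "n * s = N * t + g"
      using bezout_nat[of n N] unfolding g_def by blast
    have "(w ^ s) ^ n = w ^ (N * t + g)"
      using st by (simp add: mult.commute flip: power_mult)
    also have "\<dots> = u / z ^ n" by (simp add: power_add power_mult wN w)
    finally have "(w ^ s) ^ n = u / z ^ n" .
    moreover have "(w ^ s) ^ N = 1"
      by (metis wN power_mult mult.commute power_one)
    ultimately show ?thesis using that by blast
  qed
  have "(y * z) ^ N = c" "u = (y * z) ^ n"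
    using y z \<open>z \<noteq> 0\<close> by (auto simp: power_mult_distrib)
  thus "u \<in> (\<lambda>y. y ^ n) ` {y. y ^ N = c}" by blast
qed

section \<open>The involution sending \<open>u\<close> to \<open>c / u\<close> and the values
  \<open>u + c / u\<close>\<close>

lemma plus_div_eq_iff:
  fixes c u v :: "'a::field"
  assumes "u \<noteq> 0" "v \<noteq> 0"
  shows "u + c / u = v + c / v \<longleftrightarrow> u = v \<or> u = c / v"
proof -
  have "(u - v) * (u * v - c) = (u + c / u - (v + c / v)) * (u * v)"
    using assms by (simp add: field_simps)
  hence "u + c / u = v + c / v \<longleftrightarrow> u = v \<or> u * v = c"
    using assms by (metis eq_iff_diff_eq_0 mult_eq_0_iff)
  thus ?thesis using assms by (simp add: eq_divide_eq)
qed

text \<open>The fibres are the orbits of the involution. A two-element orbit sums to its value; a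
  fixed point, necessarily \<open>e\<close> or \<open>-e\<close>, has value twice itself and must be
  counted once more.\<close>

lemma sum_image_plus_div:
  fixes W :: "'a::field set"
  assumes W: "finite W" "0 \<notin> W" "\<And>u. u \<in> W \<Longrightarrow> e ^ 2 / u \<in> W" and e: "e \<noteq> 0"
  shows "\<Sum>((\<lambda>u. u + e ^ 2 / u) ` W) = \<Sum>W + \<Sum>(W \<inter> {e, -e})"
proof -
  let ?g = "\<lambda>u. u + e ^ 2 / u"
  have "\<Sum>W + \<Sum>(W \<inter> {e, -e}) = (\<Sum>u\<in>W. u + (if u \<in> {e, -e} then u else 0))"
    using W(1) by (simp add: sum.distrib sum.inter_restrict del: insert_iff)
  also have "\<dots> = (\<Sum>w\<in>?g ` W. \<Sum>u | u \<in> W \<and> ?g u = w. u + (if u \<in> {e, -e} then u else 0))"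
    by (rule sum.image_gen[OF W(1)])
  also have "\<dots> = (\<Sum>w\<in>?g ` W. w)"
  proof (rule sum.cong[OF refl])
    fix w assume "w \<in> ?g ` W"
    then obtain v where v: "v \<in> W" "w = ?g v" by auto
    have v0: "v \<noteq> 0" using v W by auto
    have "u = v \<or> u = e ^ 2 / v" if "u \<in> W" "?g u = w" for u
    proof -
      have "u \<noteq> 0" using that W by auto
      thus ?thesis using that(2) v(2) v0 plus_div_eq_iff by metis
    qed
    hence "{u. u \<in> W \<and> ?g u = w} \<subseteq> {v, e ^ 2 / v}" by blast
    moreover have "?g (e ^ 2 / v) = w" using v v0 e by simp
    hence "{v, e ^ 2 / v} \<subseteq> {u. u \<in> W \<and> ?g u = w}"
      using v(1) W(3)[OF v(1)] v(2)[symmetric] by simp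
    ultimately have fib: "{u. u \<in> W \<and> ?g u = w} = {v, e ^ 2 / v}" by (rule subset_antisym)
    have fixed: "z = e ^ 2 / z \<longleftrightarrow> z \<in> {e, -e}" if "z \<noteq> 0" for z
    proof -
      have "z = e ^ 2 / z \<longleftrightarrow> z ^ 2 = e ^ 2"
        using that by (simp add: eq_divide_eq power2_eq_square)
      thus ?thesis by (simp add: power2_eq_iff)
    qed
    show "(\<Sum>u | u \<in> W \<and> ?g u = w. u + (if u \<in> {e, -e} then u else 0)) = w"
    proof (cases "v \<in> {e, -e}")
      case True
      hence "e ^ 2 / v = v" using fixed[OF v0] by metis
      thus ?thesis using True v(2) unfolding fib by simp
    next
      case False
      have ne: "v \<noteq> e ^ 2 / v" using fixed[OF v0] False by blast
      have "e ^ 2 / v \<noteq> 0" "e ^ 2 / (e ^ 2 / v) = v" using v0 e by simp_all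
      hence "e ^ 2 / v \<notin> {e, -e}" using fixed[of "e ^ 2 / v"] ne by metis
      thus ?thesis using False ne v(2) unfolding fib by simp
    qed
  qed
  finally show ?thesis by simp
qed

section \<open>Parity of the cofactors, and the sum over the two cosets\<close>

lemma odd_div_gcd_iff:
  fixes n N :: nat
  assumes "N > 0"
  shows "odd (N div gcd n N) \<longleftrightarrow> 2 ^ multiplicity 2 N dvd n"
proof -
  define g where "g = gcd n N"
  have N: "N = g * (N div g)" by (simp add: g_def)
  have dvdN: "2 ^ multiplicity 2 N dvd N" by (rule multiplicity_dvd)
  \<comment> \<open>An odd cofactor leaves the whole 2-part of \<open>N\<close> to \<open>g\<close>;
    an even one would add a further factor 2.\<close>
  have "2 ^ multiplicity 2 N dvd g" if "odd (N div g)"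
  proof -
    have "coprime (2 ^ multiplicity 2 N) (N div g)" using that by simp
    thus ?thesis using dvdN N by (metis coprime_dvd_mult_left_iff)
  qed
  moreover have "odd (N div g)" if "2 ^ multiplicity 2 N dvd g"
  proof
    assume "even (N div g)"
    hence "2 ^ multiplicity 2 N * 2 dvd g * (N div g)" using that by (rule mult_dvd_mono[rotated])
    hence "2 ^ Suc (multiplicity 2 N) dvd N" using N by (simp add: mult.commute)
    thus False using assms by (subst (asm) power_dvd_iff_le_multiplicity) auto
  qed
  ultimately show ?thesis using dvdN by (auto simp: g_def)
qed

text \<open>As \<open>q - 1\<close> and \<open>q + 1\<close> differ by 2, one of their 2-adic
  valuations \<open>k\<close>, \<open>l\<close> is 1. So \<open>k + l - 1\<close> is their maximum,
  and an even \<open>n\<close> is divisible by at least one of \<open>2 ^ k\<close> and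
  \<open>2 ^ l\<close>.\<close>

lemma parity_cofactors:
  fixes n q :: nat
  assumes "odd q" "q > 1" "even n"
  shows "odd ((q - 1) div gcd n (q - 1)) \<or> odd ((q + 1) div gcd n (q + 1))"
    and "2 ^ (multiplicity 2 (q ^ 2 - 1) - 1) dvd n \<longleftrightarrow>
           odd ((q - 1) div gcd n (q - 1)) \<and> odd ((q + 1) div gcd n (q + 1))"
proof -
  define k l :: nat where "k = multiplicity 2 (q - 1)" and "l = multiplicity 2 (q + 1)"
  have "q ^ 2 - 1 = (q - 1) * (q + 1)"
    by (simp add: algebra_simps power2_eq_square)
  hence r: "multiplicity 2 (q ^ 2 - 1) = k + l"
    using assms unfolding k_def l_def by (subst \<open>q ^ 2 - 1 = _\<close>, subst prime_elem_multiplicity_mult_distrib) auto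
  have kl: "k \<ge> 1" "l \<ge> 1"
    unfolding k_def l_def using assms by (auto intro!: multiplicity_geI)
  have "k = 1 \<or> l = 1"
  proof (rule ccontr)
    assume "\<not> ?thesis"
    hence "2 \<le> k" "2 \<le> l" using kl by auto
    hence "2 ^ 2 dvd q - 1" "2 ^ 2 dvd q + 1"
      unfolding k_def l_def by (simp_all only: multiplicity_dvd')
    hence "2 ^ 2 dvd q + 1 - (q - 1)" using dvd_diff_nat by blast
    moreover have "q + 1 - (q - 1) = 2" using assms by simp
    ultimately show False by simp
  qed
  moreover have "2 ^ k dvd n \<or> 2 ^ l dvd n"
    using calculation assms by auto
  moreover have "2 ^ (k + l - 1) dvd n \<longleftrightarrow> 2 ^ k dvd n \<and> 2 ^ l dvd n"
    using calculation assms by auto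
  ultimately show "odd ((q - 1) div gcd n (q - 1)) \<or> odd ((q + 1) div gcd n (q + 1))"
    and "2 ^ (multiplicity 2 (q ^ 2 - 1) - 1) dvd n \<longleftrightarrow>
           odd ((q - 1) div gcd n (q - 1)) \<and> odd ((q + 1) div gcd n (q + 1))"
    using assms r by (simp_all add: odd_div_gcd_iff k_def l_def)
qed

text \<open>The computation in the closure: \<open>A\<close> stands for the image of
  \<open>a\<close>, and \<open>c\<close> for that of its quadratic character.\<close>

lemma sum_coset_values:
  fixes A c :: "'a::alg_closed_field"
  assumes q: "odd q" "q > 1" "of_nat q = (0::'a)" and n: "even n"
    and A: "A \<noteq> 0" "A ^ (q - 1) = 1" and c: "c = A ^ ((q - 1) div 2)"
    and d: "d = gcd n (q - 1)" and \<delta>: "\<delta> = gcd n (q + 1)"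
    and r: "r = multiplicity 2 (q ^ 2 - 1)"
  shows "\<Sum>((\<lambda>u. u + A ^ n / u) ` (\<lambda>y. y ^ n) ` ({y. y ^ (q - 1) = 1} \<union> {y. y ^ (q + 1) = A})) =
      (if 2 ^ (r - 1) dvd n then 0 else - (c ^ (n div d + n div \<delta>) * A ^ (n div 2)))
      + (if (q - 1) dvd n then c ^ (n div d) * A ^ (n div 2) else 0)
      + (if (q + 1) dvd n then c ^ (n div \<delta>) * A ^ (n div 2) else 0)"
proof -
  obtain m where m: "q = 2 * m + 1" using q(1) by (rule oddE)
  obtain k where k: "n = 2 * k" using n by (rule evenE)
  define M N where "M = (q - 1) div d" and "N = (q + 1) div \<delta>"
  define e s t where "e = A ^ k" and "s = c ^ (n div d)" and "t = c ^ (n div \<delta>)"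
  define H1 H2 where "H1 = {u::'a. u ^ M = 1}" and "H2 = {u. u ^ N = A ^ (n div \<delta>)}"
  have two: "(2::'a) \<noteq> 0" using q(3) by (auto simp: m)
  have pos: "M > 0" "N > 0"
    using q(2) by (auto simp: M_def N_def d \<delta> div_greater_zero_iff intro: gcd_le2_nat)
  have Md: "M * d = q - 1" and N\<delta>: "N * \<delta> = q + 1" and nd: "n div d * d = n"
    and n\<delta>: "n div \<delta> * \<delta> = n"
    by (simp_all add: M_def N_def d \<delta>)
  \<comment> \<open>Because \<open>q\<close> vanishes in the field, \<open>q - 1\<close> and
    \<open>q + 1\<close> become -1 and 1, so their divisors \<open>M\<close> and \<open>N\<close>
    are nonzero there, as the root sums require.\<close>
  have "of_nat M * of_nat d = (-1::'a)"
    using q(3) by (simp add: m Md flip: of_nat_mult) (simp add: eq_neg_iff_add_eq_0 add.commute)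
  hence M0: "of_nat M \<noteq> (0::'a)" by auto
  have "of_nat N * of_nat \<delta> = (1::'a)"
    using q(3) N\<delta> by (metis add_0 of_nat_1 of_nat_add of_nat_mult)
  hence N0: "of_nat N \<noteq> (0::'a)" by auto
  have "c ^ 2 = 1" using A(2) by (simp add: c m mult.commute flip: power_mult)
  hence st2: "s ^ 2 = 1" "t ^ 2 = 1"
    unfolding s_def t_def by (metis mult.commute power_mult power_one)+
  hence st: "s = 1 \<or> s = -1" "t = 1 \<or> t = -1" by (simp_all add: power2_eq_1_iff)
  have e0: "e \<noteq> 0" using A by (simp add: e_def)
  have e2: "e ^ 2 = A ^ n" by (simp add: e_def k mult.commute flip: power_mult)
  have d0: "d > 0" "\<delta> > 0" using q(2) by (auto simp: d \<delta>)
  \<comment> \<open>The exponent of \<open>A\<close> in \<open>e ^ M\<close> becomes a multiple of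
    \<open>m\<close>, so \<open>e ^ M\<close> is the power \<open>s\<close> of \<open>c\<close>; the
    sign \<open>s\<close> decides whether \<open>e\<close> lies in \<open>H1\<close>.\<close>
  have "k * M * (2 * d) = m * (n div d) * (2 * d)"
  proof -
    have "k * M * (2 * d) = 2 * k * (M * d)" by simp
    also have "\<dots> = (n div d * d) * (2 * m)" using Md nd by (simp add: m k)
    finally show ?thesis by (simp add: algebra_simps)
  qed
  hence "k * M = m * (n div d)" using d0 by simp
  hence eM: "e ^ M = s" by (simp add: e_def s_def c m flip: power_mult)
  \<comment> \<open>Likewise \<open>e ^ N\<close> differs from the constant defining
    \<open>H2\<close> by the sign \<open>t\<close>.\<close>
  have "k * N * (2 * \<delta>) = (n div \<delta>) * (m + 1) * (2 * \<delta>)"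
  proof -
    have "k * N * (2 * \<delta>) = 2 * k * (N * \<delta>)" by simp
    also have "\<dots> = (n div \<delta> * \<delta>) * (2 * m + 2)" using N\<delta> n\<delta> by (simp add: m k)
    finally show ?thesis by (simp add: algebra_simps)
  qed
  hence "k * N = n div \<delta> + m * (n div \<delta>)" using d0 by simp
  hence eN: "e ^ N = A ^ (n div \<delta>) * t"
    by (simp add: e_def t_def c m power_add flip: power_mult)
  have An: "A ^ (n div \<delta>) \<noteq> 0" using A by simp
  \<comment> \<open>This and the next fact make the involution preserve each coset
    separately.\<close>
  have AM: "(A ^ n) ^ M = 1" using eM st2(1) by (metis e2 mult.commute power_mult)
  have AN: "(A ^ n) ^ N = (A ^ (n div \<delta>)) ^ 2"
  proof -
    have "(A ^ n) ^ N = (e ^ N) ^ 2" by (metis e2 mult.commute power_mult)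
    thus ?thesis using st2(2) by (simp add: eN power_mult_distrib)
  qed
  have images: "(\<lambda>y. y ^ n) ` ({y. y ^ (q - 1) = 1} \<union> {y. y ^ (q + 1) = A}) = H1 \<union> H2"
    using q(2) A(1) power_image_nth_roots[of "q - 1" "1::'a" n] power_image_nth_roots[of "q + 1" A n]
    by (simp add: image_Un H1_def H2_def M_def N_def d \<delta>)
  have fin: "finite H1" "finite H2"
    using pos by (simp_all add: H1_def H2_def finite_nth_roots_field)
  have "0 \<notin> H1 \<union> H2" using pos A by (auto simp: H1_def H2_def power_0_left)
  moreover have "e ^ 2 / u \<in> H1 \<union> H2" if "u \<in> H1 \<union> H2" for u
    using that
  proof
    assume "u \<in> H1"
    hence "e ^ 2 / u \<in> H1" using AM unfolding H1_def e2 by (simp add: power_divide)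
    thus ?thesis ..
  next
    assume "u \<in> H2"
    hence "e ^ 2 / u \<in> H2"
      using AN An unfolding H2_def e2 by (simp add: power_divide power2_eq_square)
    thus ?thesis ..
  qed
  ultimately have "\<Sum>((\<lambda>u. u + A ^ n / u) ` (H1 \<union> H2)) =
      \<Sum>(H1 \<union> H2) + \<Sum>((H1 \<union> H2) \<inter> {e, -e})"
    using sum_image_plus_div[of "H1 \<union> H2" e] fin e0 by (simp add: e2)
  also have "\<Sum>(H1 \<union> H2) = \<Sum>H1 + \<Sum>H2 - \<Sum>(H1 \<inter> H2)"
    using fin by (rule sum_Un)
  \<comment> \<open>A common element has \<open>u ^ (q - 1) = 1\<close> and
    \<open>u ^ (q + 1) = A ^ n\<close>, hence \<open>u ^ 2 = e ^ 2\<close>.\<close>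
  also have "H1 \<inter> H2 = H1 \<inter> H2 \<inter> {e, -e}"
  proof -
    have "u \<in> {e, -e}" if u: "u \<in> H1 \<inter> H2" for u
    proof -
      have "H1 = (\<lambda>y. y ^ n) ` {y. y ^ (q - 1) = 1}"
        using power_image_nth_roots[of "q - 1" "1::'a" n] q(2) by (simp add: H1_def M_def d)
      then obtain y where y: "y ^ (q - 1) = 1" "u = y ^ n" using u by blast
      have "u ^ (q - 1) = 1" using y by (metis mult.commute power_mult power_one)
      have "u ^ N = A ^ (n div \<delta>)" using u by (simp add: H2_def)
      hence "u ^ (N * \<delta>) = A ^ (n div \<delta> * \<delta>)" by (simp only: power_mult)
      hence "u ^ (q + 1) = A ^ n" by (simp only: N\<delta> n\<delta>)
      hence "u ^ 2 * u ^ (q - 1) = e ^ 2" using q(2) by (simp flip: power_add add: e2)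
      thus ?thesis using \<open>u ^ (q - 1) = 1\<close> by (simp add: power2_eq_iff)
    qed
    thus ?thesis by blast
  qed
  \<comment> \<open>If \<open>M = 1\<close>, the only element of \<open>H1\<close> is 1, and
    \<open>e = s\<close> with \<open>s ^ 2 = 1\<close> rewrites it as \<open>s * e\<close>. The sum
    of \<open>H2\<close> is treated in the same way.\<close>
  also have "\<Sum>H1 = (if (q - 1) dvd n then s * e else 0)"
  proof -
    have "M = 1 \<longleftrightarrow> (q - 1) dvd n"
    proof
      assume "M = 1"
      hence "d = q - 1" using Md by simp
      thus "(q - 1) dvd n" by (metis d gcd_dvd1)
    next
      assume "(q - 1) dvd n"
      thus "M = 1" using q(2) by (simp add: M_def d gcd_nat.absorb2)
    qed
    thus ?thesis unfolding H1_def using sum_nth_roots_alg_closed[OF M0, of 1] eM st2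
      by (auto simp: power2_eq_square)
  qed
  also have "\<Sum>H2 = (if (q + 1) dvd n then t * e else 0)"
  proof -
    have "N = 1 \<longleftrightarrow> (q + 1) dvd n"
    proof
      assume "N = 1"
      hence "\<delta> = q + 1" using N\<delta> by simp
      thus "(q + 1) dvd n" by (metis \<delta> gcd_dvd1)
    next
      assume "(q + 1) dvd n"
      thus "N = 1" by (simp add: N_def \<delta> gcd_nat.absorb2)
    qed
    thus ?thesis unfolding H2_def using sum_nth_roots_alg_closed[OF N0, of "A ^ (n div \<delta>)"] eN st2
      by (auto simp: power2_eq_square)
  qed
  finally have total: "\<Sum>((\<lambda>u. u + A ^ n / u) ` (H1 \<union> H2)) =
      (if (q - 1) dvd n then s * e else 0) + (if (q + 1) dvd n then t * e else 0)
      + (\<Sum>((H1 \<union> H2) \<inter> {e, -e}) - \<Sum>(H1 \<inter> H2 \<inter> {e, -e}))"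
    by simp
  have neg: "e \<noteq> -e" "(1::'a) \<noteq> -1" "(-1::'a) \<noteq> 1"
    using two e0 by (auto simp: eq_neg_iff_add_eq_0 neg_eq_iff_add_eq_0 simp flip: mult_2)
  have pm: "\<Sum>(B \<inter> {e, -e}) = (if e \<in> B then e else 0) + (if -e \<in> B then -e else 0)" for B
    using neg(1) by (auto simp: Int_insert_right)
  have mem: "e \<in> H1 \<longleftrightarrow> s = 1" "-e \<in> H1 \<longleftrightarrow> (if even M then s = 1 else s = -1)"
    "e \<in> H2 \<longleftrightarrow> t = 1" "-e \<in> H2 \<longleftrightarrow> (if even N then t = 1 else t = -1)"
    using eM eN An st by (auto simp: H1_def H2_def neg two)
  have "odd M \<or> odd N" "2 ^ (r - 1) dvd n \<longleftrightarrow> odd M \<and> odd N"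
    using parity_cofactors[OF q(1,2) n] by (simp_all add: M_def N_def d \<delta> r)
  \<comment> \<open>With \<open>M\<close> odd, \<open>H1\<close> contains exactly one of
    \<open>e\<close>, \<open>-e\<close>, namely \<open>s * e\<close>; with \<open>M\<close> even,
    both or neither according to \<open>s\<close>. The same holds for \<open>H2\<close> with
    \<open>N\<close> and \<open>t\<close>. Two odd cofactors cancel; one odd and one even leave
    \<open>- (s * t * e)\<close>.\<close>
  hence "\<Sum>((H1 \<union> H2) \<inter> {e, -e}) - \<Sum>(H1 \<inter> H2 \<inter> {e, -e}) =
      (if 2 ^ (r - 1) dvd n then 0 else - (s * t * e))"
    unfolding pm using st by (auto simp: mem neg)
  thus ?thesis unfolding images total
    by (simp add: s_def t_def e_def k power_add)
qed

section \<open>Frobenius and the copy of the finite field in its algebraic closure\<close>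

lemma power_card_add_alg_closure:
  fixes x y :: "'k::finite_field alg_closure"
  assumes "primepow CARD('k)"
  shows "(x + y) ^ CARD('k) = x ^ CARD('k) + y ^ CARD('k)"
proof -
  obtain p k where pk: "Factorial_Ring.prime p" "CARD('k) = p ^ k" "k > 0"
    using assms by (auto simp: primepow_def)
  have p: "Factorial_Ring.prime CHAR('k)" by simp
  \<comment> \<open>Identifying \<open>p\<close> with the characteristic makes the q-th power map an
    iterate of Frobenius, hence additive.\<close>
  have "CHAR('k) dvd p ^ k" using CHAR_dvd_CARD[where ?'a = 'k] pk by simp
  hence "CHAR('k) = p"
    using p pk(1) by (metis prime_dvd_power primes_dvd_imp_eq)
  thus ?thesis using freshmans_dream'[of "CARD('k)" k x y] p pk by simp
qed

text \<open>The field embeds injectively into the roots of X^q - X, of which there are at most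
  q.\<close>

lemma range_to_ac_finite_field: "range to_ac = {z :: 'k::finite_field alg_closure. z ^ CARD('k) = z}"
proof (rule card_seteq)
  have gt: "CARD('k) > 1"
    using card_mono[of "UNIV::'k set" "{0, 1}"] by simp
  define p :: "'k alg_closure poly" where "p = Polynomial.monom 1 CARD('k) - [:0, 1:]"
  have "Polynomial.coeff p (CARD('k)) = 1"
    using gt by (auto simp: p_def coeff_pCons split: nat.split)
  hence "p \<noteq> 0" by (metis Polynomial.coeff_0 zero_neq_one)
  have roots: "{z. z ^ CARD('k) = z} = {z. poly p z = 0}"
    by (auto simp: p_def Polynomial.poly_monom)
  show "finite {z :: 'k alg_closure. z ^ CARD('k) = z}"
    unfolding roots by (rule poly_roots_finite[OF \<open>p \<noteq> 0\<close>])
  have "Polynomial.degree p \<le> CARD('k)"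
    unfolding p_def using gt by (intro Polynomial.degree_diff_le) (auto simp: Polynomial.degree_monom_le)
  hence "card {z. poly p z = 0} \<le> CARD('k)"
    using card_poly_roots_bound[OF \<open>p \<noteq> 0\<close>] by linarith
  thus "card {z :: 'k alg_closure. z ^ CARD('k) = z} \<le> card (range (to_ac :: 'k \<Rightarrow> _))"
    unfolding roots by (simp add: card_image inj_to_ac)
qed (auto simp: finite_field_power_card_eq_same simp flip: to_ac_power)

text \<open>Any \<open>z\<close> is \<open>y + A / y\<close> for a root \<open>y\<close> of X^2 - zX
  + A. It lies in the finite field iff Frobenius fixes it, that is, iff Frobenius fixes
  \<open>y\<close> or swaps it with \<open>A / y\<close>.\<close>

lemma range_to_ac_eq_plus_div:
  fixes a :: "'k::finite_field"
  assumes "primepow CARD('k)" "a \<noteq> 0"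
  defines "A \<equiv> to_ac a"
  shows "range to_ac = (\<lambda>y. y + A / y) ` ({y. y ^ (CARD('k) - 1) = 1} \<union> {y. y ^ (CARD('k) + 1) = A})"
    (is "_ = ?g ` (?Y1 \<union> ?Y2)")
proof -
  define q where "q = CARD('k)"
  have q: "q > 1" using primepow_gt_Suc_0[OF assms(1)] by (simp add: q_def)
  have A: "A \<noteq> 0" "A ^ q = A"
    using assms by (simp_all add: q_def finite_field_power_card_eq_same flip: to_ac_power)
  have Y: "y \<in> ?Y1 \<union> ?Y2 \<longleftrightarrow> y ^ q = y \<or> y ^ q = A / y" if "y \<noteq> 0" for y
  proof -
    have "y ^ q = y * y ^ (q - 1)" "y ^ (q + 1) = y ^ q * y" using q by (simp_all add: power_eq_if)
    hence "y ^ (q - 1) = 1 \<longleftrightarrow> y ^ q = y" "y ^ (q + 1) = A \<longleftrightarrow> y ^ q = A / y"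
      using that by (simp_all only: eq_divide_eq mult_cancel_left1 mult_cancel_left2 refl) auto
    thus ?thesis unfolding q_def by blast
  qed
  have Y0: "y \<noteq> 0" if "y \<in> ?Y1 \<union> ?Y2" for y
    using that q A by (auto simp: q_def power_0_left)
  have range: "y + A / y \<in> range to_ac \<longleftrightarrow> y ^ q = y \<or> y ^ q = A / y" if y: "y \<noteq> 0" for y
  proof -
    have "y + A / y \<in> range to_ac \<longleftrightarrow> y ^ q + A / y ^ q = y + A / y"
      using power_card_add_alg_closure[OF assms(1), of y "A / y"] A
      by (simp add: range_to_ac_finite_field q_def power_divide)
    also have "\<dots> \<longleftrightarrow> y ^ q = y \<or> y ^ q = A / y" using y by (intro plus_div_eq_iff) auto
    finally show ?thesis .
  qed
  have ex: "\<exists>y. y \<noteq> 0 \<and> z = y + A / y" for z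
  proof -
    obtain y where "poly [:A, -z, 1:] y = 0"
      using alg_closed_imp_poly_has_root[of "[:A, -z, 1:]"] by auto
    hence "y * y + A = z * y" by (simp add: algebra_simps)
    moreover from this have "y \<noteq> 0" using A by auto
    ultimately show ?thesis by (intro exI[of _ y]) (simp add: field_simps)
  qed
  show ?thesis
  proof (intro equalityI subsetI)
    fix z :: "'k alg_closure" assume z: "z \<in> range (to_ac :: 'k \<Rightarrow> _)"
    obtain y where y: "y \<noteq> 0" "z = y + A / y" using ex by blast
    hence "y \<in> ?Y1 \<union> ?Y2" using z range[OF y(1)] Y[OF y(1)] by (simp only:)
    thus "z \<in> ?g ` (?Y1 \<union> ?Y2)" using y(2) by (rule rev_image_eqI)
  next
    fix z assume "z \<in> ?g ` (?Y1 \<union> ?Y2)"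
    then obtain y where y: "y \<in> ?Y1 \<union> ?Y2" "z = y + A / y" by (rule imageE)
    have "y \<noteq> 0" using Y0[OF y(1)] .
    thus "z \<in> range (to_ac :: 'k \<Rightarrow> _)" using y range[of y] Y[of y] by (simp only: simp_thms)
  qed
qed

section \<open>Transfer of the sum back to the finite field\<close>

theorem theorem1p2:
  fixes a :: int and n q d \<delta> r :: nat and T1 T2 T3 :: "'k::finite_field"
  assumes "even n"
    and "primepow q" and "odd q" and "CARD('k) = q"
    and "(of_int a :: 'k) \<noteq> 0"
    and "d = gcd n (q - 1)"
    and "\<delta> = gcd n (q + 1)"
    and "r = multiplicity 2 (q ^ 2 - 1)"
    and "T1 = (if 2 ^ (r - 1) dvd n then 0
               else - (quadratic_char (of_int a) ^ (n div d + n div \<delta>) * of_int a ^ (n div 2)))"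
    and "T2 = (if (q - 1) dvd n
               then quadratic_char (of_int a) ^ (n div d) * of_int a ^ (n div 2) else 0)"
    and "T3 = (if (q + 1) dvd n
               then quadratic_char (of_int a) ^ (n div \<delta>) * of_int a ^ (n div 2) else 0)"
  shows "value_sum (dickson_poly n a) = T1 + T2 + T3"
proof -
  define A :: "'k alg_closure" where "A = to_ac (of_int a)"
  define Y where "Y = {y. y ^ (q - 1) = 1} \<union> {y. y ^ (q + 1) = A}"
  have q: "q > 1" using assms(2) primepow_gt_Suc_0 by simp
  have A0: "A \<noteq> 0" using assms(5) unfolding A_def by (simp del: to_ac_of_int)
  have "of_int a ^ (q - 1) = (1::'k)"
    using finite_field_power_card_eq_same[of "of_int a :: 'k"] assms(4,5) q
    by (simp add: power_eq_if)
  hence A1: "A ^ (q - 1) = 1" unfolding A_def by (metis to_ac_1 to_ac_power)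
  have q0: "of_nat q = (0 :: 'k alg_closure)"
    using CHAR_dvd_CARD[where ?'a = 'k] assms(4) by (simp add: of_nat_eq_0_iff_char_dvd)
  have Y0: "y \<noteq> 0" if "y \<in> Y" for y
    using that q A0 by (auto simp: Y_def power_0_left)
  have "to_ac ` value_set (dickson_poly n a) = poly (dickson_poly n A) ` range to_ac"
    by (simp add: value_set_def map_poly_of_int_dickson_poly image_image to_ac_poly_dickson_poly A_def
        del: to_ac_of_int)
  also have "range to_ac = (\<lambda>y. y + A / y) ` Y"
    using range_to_ac_eq_plus_div[of "of_int a :: 'k"] assms(2,4,5) by (simp add: A_def Y_def)
  also have "poly (dickson_poly n A) ` \<dots> = (\<lambda>u. u + A ^ n / u) ` (\<lambda>y. y ^ n) ` Y"
    using Y0 by (simp add: image_image poly_dickson_poly_plus_div cong: image_cong)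
  finally have image: "to_ac ` value_set (dickson_poly n a) =
    (\<lambda>u. u + A ^ n / u) ` (\<lambda>y. y ^ n) ` Y" .
  \<comment> \<open>Injectivity of \<open>to_ac\<close> keeps distinct values distinct, so their sum
    may be evaluated in the closure.\<close>
  have "to_ac (value_sum (dickson_poly n a) :: 'k) = \<Sum>(to_ac ` value_set (dickson_poly n a))"
    by (simp add: value_sum_def to_ac_sum sum.reindex inj_on_subset[OF inj_to_ac])
  also have "\<dots> = to_ac (T1 + T2 + T3)"
    unfolding image Y_def
    by (subst sum_coset_values[OF assms(3) q q0 assms(1) A0 A1 refl assms(6-8)])
      (simp add: assms(4,9-11) A_def quadratic_char_def del: to_ac_of_int)
  finally show ?thesis by (simp only: to_ac_eq_iff)
qed

end
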